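(* Let $u$ and $v$ be vertices in a finite simple graph $G$ such that $d_G(u,v)\ge 3$, and let $\epsilon$ be the elementary harmonious homomorphism of $G$ that identifies $u$ and $v$. Then $h(\epsilon(G))=h(G)$ if and only if there exists a harmonious $h(G)$-coloring of $G$ assigning the same color to $u$ and $v$.
   Context: Graphs are finite and simple; $d_G(u,v)$ is the distance in $G$ (infinite if $u,v$ lie in different components). A harmonious $k$-coloring of a graph $G$ is a proper vertex coloring with $k$ colors such that every (unordered) pair of colors appears on at most one edge. The harmonious chromatic number $h(G)$ is the minimum $k$ such that $G$ has a harmonious $k$-coloring. An elementary harmonious homomorphism $\epsilon$ of $G$ identifying $u$ and $v$ (with $d_G(u,v)\geq 3$) maps both $u$ and $v$ to $u$ and fixes every vertex of $V(G)\setminus\{u,v\}$; its image $\epsilon(G)$ has vertex set $V(G)\setminus\{v\}$ and edge set $\{\epsilon(x)\epsilon(y): xy\in E(G)\}$. *)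

theory Defs
  imports Main "HOL-Library.Extended_Nat"
begin

text \<open>A graph is given by its vertex set and its set of edges, an edge being the unordered
  pair (two-element set) of its ends.\<close>

record 'a graph =
  verts :: "'a set"
  edges :: "'a set set"

definition finite_simple_graph :: "'a graph \<Rightarrow> bool" where
  "finite_simple_graph G \<longleftrightarrow>
     finite (verts G) \<and> (\<forall>e \<in> edges G. e \<subseteq> verts G \<and> card e = 2)"

inductive walk :: "'a graph \<Rightarrow> 'a \<Rightarrow> nat \<Rightarrow> 'a \<Rightarrow> bool" for G where
  walk_refl: "x \<in> verts G \<Longrightarrow> walk G x 0 x"
| walk_step: "{x, y} \<in> edges G \<Longrightarrow> walk G y n z \<Longrightarrow> walk G x (Suc n) z"

text \<open>The infimum of the empty set in \<^typ>\<open>enat\<close> is \<open>\<infinity>\<close>, which is the distance of vertices in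
  different components.\<close>

definition graph_dist :: "'a graph \<Rightarrow> 'a \<Rightarrow> 'a \<Rightarrow> enat" where
  "graph_dist G x y = Inf {enat n | n. walk G x n y}"

definition proper_coloring :: "'a graph \<Rightarrow> nat \<Rightarrow> ('a \<Rightarrow> nat) \<Rightarrow> bool" where
  "proper_coloring G k c \<longleftrightarrow>
     c ` verts G \<subseteq> {..<k} \<and> (\<forall>x y. {x, y} \<in> edges G \<longrightarrow> c x \<noteq> c y)"

definition harmonious_coloring :: "'a graph \<Rightarrow> nat \<Rightarrow> ('a \<Rightarrow> nat) \<Rightarrow> bool" where
  "harmonious_coloring G k c \<longleftrightarrow>
     proper_coloring G k c \<and> (\<forall>a b. \<exists>\<^sub>\<le>\<^sub>1 e. e \<in> edges G \<and> c ` e = {a, b})"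

text \<open>The minimum exists for every finite simple graph; see \<open>harmonious_coloring_exists\<close> below.\<close>

definition harmonious_chromatic_number :: "'a graph \<Rightarrow> nat" where
  "harmonious_chromatic_number G = (LEAST k. \<exists>c. harmonious_coloring G k c)"

definition elem_hom :: "'a \<Rightarrow> 'a \<Rightarrow> 'a \<Rightarrow> 'a" where
  "elem_hom u v = id(v := u)"

definition elem_hom_image :: "'a \<Rightarrow> 'a \<Rightarrow> 'a graph \<Rightarrow> 'a graph" where
  "elem_hom_image u v G =
     \<lparr>verts = verts G - {v},
      edges = {{elem_hom u v x, elem_hom u v y} | x y. {x, y} \<in> edges G}\<rparr>"

lemma harmonious_coloring_exists:
  assumes "finite_simple_graph G"
  shows "\<exists>k c. harmonious_coloring G k c"
proof -
  have fin: "finite (verts G)"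
    and E: "\<And>e. e \<in> edges G \<Longrightarrow> e \<subseteq> verts G \<and> card e = 2"
    using assms by (auto simp: finite_simple_graph_def)
  obtain c :: "'a \<Rightarrow> nat" and n where c: "c ` verts G = {i. i < n}" "inj_on c (verts G)"
    using finite_imp_nat_seg_image_inj_on[OF fin]
      finite_imp_inj_to_nat_seg[OF fin] by blast
  have "c x \<noteq> c y" if "{x, y} \<in> edges G" for x y
    using E[OF that] c(2) by (auto simp: inj_on_def card_insert_if split: if_splits)
  then have "proper_coloring G n c"
    using c(1) by (auto simp: proper_coloring_def)
  moreover have "e = f" if "e \<in> edges G" "f \<in> edges G" "c ` e = c ` f" for e f
    using inj_on_image_eq_iff[OF c(2)] E that by blast
  ultimately have "harmonious_coloring G n c"
    by (auto simp: harmonious_coloring_def Uniq_def)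
  then show ?thesis by blast
qed

lemma finite_simple_graph_elem_hom_image:
  assumes G: "finite_simple_graph G" and uv: "u \<in> verts G" "v \<in> verts G"
    and d: "graph_dist G u v \<ge> 3"
  shows "finite_simple_graph (elem_hom_image u v G)"
proof -
  have E: "\<And>e. e \<in> edges G \<Longrightarrow> e \<subseteq> verts G \<and> card e = 2"
    using G by (auto simp: finite_simple_graph_def)
  have no: "n \<ge> 3" if "walk G u n v" for n
  proof -
    have "graph_dist G u v \<le> enat n"
      using that by (auto simp: graph_dist_def intro: Inf_lower)
    with d have "(3::enat) \<le> enat n" by (rule order_trans)
    then show ?thesis by (simp add: numeral_eq_enat)
  qed
  have "u \<noteq> v" using no[of 0] uv by (auto intro: walk.intros)
  have nadj: "{u, v} \<notin> edges G"
    using no[of "Suc 0"] uv by (auto intro: walk.intros)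
  have "elem_hom u v x \<noteq> elem_hom u v y \<and> elem_hom u v x \<in> verts G - {v} \<and>
      elem_hom u v y \<in> verts G - {v}" if "{x, y} \<in> edges G" for x y
  proof -
    have "x \<noteq> y" "x \<in> verts G" "y \<in> verts G"
      using E[OF that] by (auto simp: card_insert_if split: if_splits)
    then show ?thesis
      using that nadj \<open>u \<noteq> v\<close> uv by (auto simp: elem_hom_def insert_commute)
  qed
  then show ?thesis
    using G by (fastforce simp: finite_simple_graph_def elem_hom_image_def)
qed

end

theory Submission
  imports Defs
begin

text \<open>
  Write \<open>\<epsilon>\<close> for the map that identifies \<open>u\<close> and \<open>v\<close>. Colorings of the image graph \<open>\<epsilon>(G)\<close>
  correspond to the colorings of \<open>G\<close> that factor through \<open>\<epsilon>\<close>, that is, to those that agree on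
  \<open>u\<close> and \<open>v\<close>. The point is that the correspondence \<open>c \<leftrightarrow> c \<circ> \<epsilon>\<close> respects harmoniousness in both
  directions (\<open>harmonious_coloring_comp_iff\<close>): since \<open>u\<close> and \<open>v\<close> are neither adjacent nor have a
  common neighbor, \<open>\<epsilon>\<close> merges no two edges (\<open>inj_on_edges_elem_hom\<close>), so a pair of colors appears
  on as many edges of \<open>G\<close> as of \<open>\<epsilon>(G)\<close>.

  Hence \<open>h(\<epsilon>(G))\<close> is the least number of colors in a harmonious coloring of \<open>G\<close> that gives \<open>u\<close>
  and \<open>v\<close> the same color. It is at least \<open>h(G)\<close>, with equality exactly when \<open>h(G)\<close> colors suffice
  for such a coloring.
\<close>

lemma edge_eq_doubleton:
  assumes "finite_simple_graph G" and "e \<in> edges G"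
  shows "\<exists>x y. e = {x, y}"
proof -
  have "card e = 2" using assms by (simp add: finite_simple_graph_def)
  then show ?thesis unfolding card_2_iff by blast
qed

text \<open>Properness and uniqueness of the edge of each color pair are conditions on the sets \<open>c ` e\<close>,
  and an injective action on edges transports these sets one to one.\<close>

lemma harmonious_coloring_comp_iff:
  assumes G: "finite_simple_graph G"
    and V: "verts H = f ` verts G"
    and E: "edges H = (`) f ` edges G"
    and inj: "inj_on ((`) f) (edges G)"
  shows "harmonious_coloring H k c \<longleftrightarrow> harmonious_coloring G k (c \<circ> f)"
proof -
  have proper: "(\<forall>a b. {a, b} \<in> edges H \<longrightarrow> c a \<noteq> c b) \<longleftrightarrow>
      (\<forall>x y. {x, y} \<in> edges G \<longrightarrow> c (f x) \<noteq> c (f y))" (is "?L \<longleftrightarrow> ?R")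
  proof
    assume L: ?L
    have "{f x, f y} \<in> edges H" if "{x, y} \<in> edges G" for x y
      using imageI[OF that, of "(`) f"] E by simp
    with L show ?R by blast
  next
    assume R: ?R
    show ?L
    proof (intro allI impI)
      fix a b assume "{a, b} \<in> edges H"
      then obtain e where e: "e \<in> edges G" "{a, b} = f ` e" using E by auto
      obtain x y where xy: "e = {x, y}" using edge_eq_doubleton[OF G e(1)] by blast
      then have "{a, b} = {f x, f y}" "c (f x) \<noteq> c (f y)" using e R by auto
      then show "c a \<noteq> c b" by (metis doubleton_eq_iff)
    qed
  qed
  have "(\<exists>\<^sub>\<le>\<^sub>1 e. e \<in> edges H \<and> c ` e = D) \<longleftrightarrow>
      (\<exists>\<^sub>\<le>\<^sub>1 e. e \<in> edges G \<and> (c \<circ> f) ` e = D)" for D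
  proof -
    have "(\<exists>\<^sub>\<le>\<^sub>1 e. e \<in> edges H \<and> c ` e = D) \<longleftrightarrow>
        (\<forall>e\<in>edges G. \<forall>e'\<in>edges G. c ` f ` e = D \<longrightarrow> c ` f ` e' = D \<longrightarrow> f ` e = f ` e')"
      unfolding Uniq_def E by blast
    also have "\<dots> \<longleftrightarrow>
        (\<forall>e\<in>edges G. \<forall>e'\<in>edges G. c ` f ` e = D \<longrightarrow> c ` f ` e' = D \<longrightarrow> e = e')"
      using inj_on_eq_iff[OF inj] by simp
    also have "\<dots> \<longleftrightarrow> (\<exists>\<^sub>\<le>\<^sub>1 e. e \<in> edges G \<and> (c \<circ> f) ` e = D)"
      unfolding Uniq_def image_comp[symmetric] by blast
    finally show ?thesis .
  qed
  with proper show ?thesis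
    by (simp add: harmonious_coloring_def proper_coloring_def V image_comp)
qed

lemma graph_dist_le_walk: "walk G x n y \<Longrightarrow> graph_dist G x y \<le> enat n"
  by (auto simp: graph_dist_def intro: Inf_lower)

text \<open>Two distinct edges with the same image would be \<open>uw\<close> and \<open>vw\<close>, which form a walk of length two from
  \<open>u\<close> to \<open>v\<close>.\<close>

lemma inj_on_edges_elem_hom:
  assumes G: "finite_simple_graph G" and v: "v \<in> verts G"
    and d: "graph_dist G u v \<ge> 3"
  shows "inj_on ((`) (elem_hom u v)) (edges G)"
proof -
  have far: "n \<ge> 3" if "walk G u n v" for n
    using order_trans[OF d graph_dist_le_walk[OF that]] by (simp add: numeral_eq_enat)
  have nadj: "{u, v} \<notin> edges G"
    using far[of "Suc 0"] v by (auto intro: walk.intros)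
  have no_common: False if "{u, w} \<in> edges G" "{w, v} \<in> edges G" for w
    using far[of "Suc (Suc 0)"] that v by (auto intro: walk.intros)
  have img: "elem_hom u v ` e = e" if "v \<notin> e" for e
    using that by (auto simp: elem_hom_def image_iff)
  have nbr: "\<exists>w. e = {v, w} \<and> w \<noteq> v \<and> w \<noteq> u" if e: "e \<in> edges G" "v \<in> e" for e
  proof -
    have "card e = 2" using G e by (simp add: finite_simple_graph_def)
    then obtain w where w: "e = {v, w}" "w \<noteq> v" using e by (auto simp: card_2_iff)
    then have "w \<noteq> u" using e(1) nadj by (metis insert_commute)
    with w show ?thesis by blast
  qed
  have mixed: False
    if e: "e \<in> edges G" "v \<in> e" and f: "f \<in> edges G" "v \<notin> f"
      and eq: "elem_hom u v ` e = elem_hom u v ` f" for e f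
  proof -
    obtain w where w: "e = {v, w}" "w \<noteq> v" "w \<noteq> u" using nbr[OF e] by blast
    then have "elem_hom u v ` e = {u, w}" by (simp add: elem_hom_def doubleton_eq_iff)
    then have "f = {u, w}" using eq f by (simp add: img)
    moreover have "e = {w, v}" using w by blast
    ultimately show False using no_common e f by blast
  qed
  have both: "e = f"
    if e: "e \<in> edges G" "v \<in> e" and f: "f \<in> edges G" "v \<in> f"
      and eq: "elem_hom u v ` e = elem_hom u v ` f" for e f
  proof -
    obtain w where w: "e = {v, w}" "w \<noteq> v" "w \<noteq> u" using nbr[OF e] by blast
    obtain w' where w': "f = {v, w'}" "w' \<noteq> v" "w' \<noteq> u" using nbr[OF f] by blast
    have "{u, w} = {u, w'}" using eq w w' by (simp add: elem_hom_def insert_commute)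
    then show ?thesis using w w' by (simp add: doubleton_eq_iff)
  qed
  show ?thesis
  proof (rule inj_onI)
    fix e f
    assume e: "e \<in> edges G" and f: "f \<in> edges G"
      and eq: "elem_hom u v ` e = elem_hom u v ` f"
    then have "v \<in> e \<longleftrightarrow> v \<in> f" using mixed[of e f] mixed[of f e] by argo
    then show "e = f" using both[OF e _ f _ eq] eq by (cases "v \<in> e") (simp_all add: img)
  qed
qed

lemma edges_elem_hom_image:
  assumes "finite_simple_graph G"
  shows "edges (elem_hom_image u v G) = (`) (elem_hom u v) ` edges G"
proof (intro subset_antisym subsetI)
  fix d assume "d \<in> edges (elem_hom_image u v G)"
  then obtain x y where "{x, y} \<in> edges G" "d = elem_hom u v ` {x, y}"
    by (auto simp: elem_hom_image_def)
  then show "d \<in> (`) (elem_hom u v) ` edges G" by blast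
next
  fix d assume "d \<in> (`) (elem_hom u v) ` edges G"
  then obtain e where e: "e \<in> edges G" "d = elem_hom u v ` e" by blast
  moreover obtain x y where "e = {x, y}" using edge_eq_doubleton[OF assms e(1)] by blast
  ultimately show "d \<in> edges (elem_hom_image u v G)"
    by (auto simp: elem_hom_image_def)
qed

lemma harmonious_coloring_elem_hom_image_iff:
  assumes G: "finite_simple_graph G" and uv: "u \<in> verts G" "v \<in> verts G"
    and d: "graph_dist G u v \<ge> 3"
  shows "harmonious_coloring (elem_hom_image u v G) k c \<longleftrightarrow>
    harmonious_coloring G k (c \<circ> elem_hom u v)"
proof (rule harmonious_coloring_comp_iff[OF G])
  have "u \<noteq> v"
    using order_trans[OF d graph_dist_le_walk[of G u 0 v]] uv
    by (auto simp: numeral_eq_enat intro: walk_refl)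
  then show "verts (elem_hom_image u v G) = elem_hom u v ` verts G"
    using uv by (auto simp: elem_hom_image_def elem_hom_def)
qed (use edges_elem_hom_image[OF G] inj_on_edges_elem_hom[OF G uv(2) d] in auto)

lemma harmonious_chromatic_number_le:
  "harmonious_coloring G k c \<Longrightarrow> harmonious_chromatic_number G \<le> k"
  unfolding harmonious_chromatic_number_def by (blast intro: Least_le)

lemma harmonious_chromatic_number_attained:
  assumes "finite_simple_graph G"
  shows "\<exists>c. harmonious_coloring G (harmonious_chromatic_number G) c"
  unfolding harmonious_chromatic_number_def
  by (rule LeastI_ex) (rule harmonious_coloring_exists[OF assms])

theorem theorem2:
  fixes G :: "'a graph" and u v :: 'a
  assumes "finite_simple_graph G"
    and "u \<in> verts G" and "v \<in> verts G"
    and "graph_dist G u v \<ge> 3"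
  shows "harmonious_chromatic_number (elem_hom_image u v G) = harmonious_chromatic_number G \<longleftrightarrow>
    (\<exists>c. harmonious_coloring G (harmonious_chromatic_number G) c \<and> c u = c v)"
proof -
  let ?H = "elem_hom_image u v G"
  note lift = harmonious_coloring_elem_hom_image_iff[OF assms]
  obtain d where "harmonious_coloring ?H (harmonious_chromatic_number ?H) d"
    using harmonious_chromatic_number_attained[OF finite_simple_graph_elem_hom_image[OF assms]]
    by blast
  then have d: "harmonious_coloring G (harmonious_chromatic_number ?H) (d \<circ> elem_hom u v)"
    by (simp add: lift)
  then have ge: "harmonious_chromatic_number G \<le> harmonious_chromatic_number ?H"
    by (rule harmonious_chromatic_number_le)
  show ?thesis
  proof
    assume "harmonious_chromatic_number ?H = harmonious_chromatic_number G"
    moreover have "(d \<circ> elem_hom u v) u = (d \<circ> elem_hom u v) v"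
      by (simp add: elem_hom_def)
    ultimately show "\<exists>c. harmonious_coloring G (harmonious_chromatic_number G) c \<and> c u = c v"
      using d by metis
  next
    assume "\<exists>c. harmonious_coloring G (harmonious_chromatic_number G) c \<and> c u = c v"
    then obtain c where c: "harmonious_coloring G (harmonious_chromatic_number G) c" "c u = c v"
      by blast
    have "c \<circ> elem_hom u v = c"
      using c(2) by (auto simp: elem_hom_def)
    then have "harmonious_coloring ?H (harmonious_chromatic_number G) c"
      using c(1) by (simp add: lift)
    then have "harmonious_chromatic_number ?H \<le> harmonious_chromatic_number G"
      by (rule harmonious_chromatic_number_le)
    with ge show "harmonious_chromatic_number ?H = harmonious_chromatic_number G"
      by simp
  qed
qed

end
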